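(* Let $N\ge2$, $M\ge1$, $q_1,\dots,q_N>0$, and let each $J_k:\mathbb{R}^M\to\mathbb{R}$ be convex and differentiable, with $\sum_{k=1}^Nq_kJ_k$ strongly convex with unique minimizer $w^\star$, and suppose $\sum_{k=1}^NJ_k$ is strongly convex. Let $A$ be primitive, left-stochastic and balanced with Perron vector $p$, and let $\mu_1,\dots,\mu_N>0$ satisfy $q=\beta\,\mathrm{diag}\{\mu_1,\dots,\mu_N\}p$ for some $\beta>0$. Then there exists a unique pair $(\mathcal{W}^\star,\mathcal{Y}^\star_o)\in\mathbb{R}^{NM}\times\mathbb{R}^{NM}$ with $\mathcal{Y}^\star_o$ in the range of $\mathcal{V}$ such that $$\bar{\mathcal{A}}^{\mathsf T}\mathcal{M}\nabla\mathcal{J}^o(\mathcal{W}^\star)+\mathcal{P}^{-1}\mathcal{V}\mathcal{Y}^\star_o=0,\qquad \mathcal{V}\mathcal{W}^\star=0 .$$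
   Context: $A=[a_{\ell k}]\in\mathbb{R}^{N\times N}$ is nonnegative, left-stochastic ($A^{\mathsf T}\mathbf{1}_N=\mathbf{1}_N$) and primitive, with Perron vector $p$: $Ap=p$, $\mathbf{1}_N^{\mathsf T}p=1$, $p\succ0$; $P=\mathrm{diag}(p)$, balanced means $PA^{\mathsf T}=AP$. $q=(q_1,\dots,q_N)^{\mathsf T}$, $\bar A=(I_N+A)/2$. The symmetric positive semidefinite matrix $(P-AP)/2$ has eigendecomposition $U\Sigma U^{\mathsf T}$ and $V=U\Sigma^{1/2}U^{\mathsf T}$. $\bar{\mathcal{A}}=\bar A\otimes I_M$, $\mathcal{P}=P\otimes I_M$, $\mathcal{V}=V\otimes I_M$, $\mathcal{M}=\mathrm{diag}\{\mu_1I_M,\dots,\mu_NI_M\}$, and $\nabla\mathcal{J}^o(\mathcal{W})=\mathrm{col}\{\nabla J_1(w_1),\dots,\nabla J_N(w_N)\}$ for $\mathcal{W}=\mathrm{col}\{w_1,\dots,w_N\}$. *)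

theory Defs
  imports "HOL-Analysis.Analysis"
begin

text \<open>Matrix power for square matrices.\<close>
fun mpow :: "real^'n^'n \<Rightarrow> nat \<Rightarrow> real^'n^'n" where
  "mpow A 0 = mat 1"
| "mpow A (Suc k) = A ** mpow A k"

definition nonneg_matrix :: "real^'n^'n \<Rightarrow> bool" where
  "nonneg_matrix A \<longleftrightarrow> (\<forall>i j. A$i$j \<ge> 0)"

definition primitive_matrix :: "real^'n^'n \<Rightarrow> bool" where
  "primitive_matrix A \<longleftrightarrow> nonneg_matrix A \<and> (\<exists>k>0. \<forall>i j. mpow A k $i$j > 0)"

text \<open>Left-stochastic: A^T 1 = 1, i.e. every column sums to one.\<close>
definition left_stochastic :: "real^'n^'n \<Rightarrow> bool" where
  "left_stochastic A \<longleftrightarrow> nonneg_matrix A \<and> transpose A *v (\<chi> i. 1) = (\<chi> i. 1)"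

text \<open>Diagonal matrix with given diagonal.\<close>
definition mdiag :: "real^'n \<Rightarrow> real^'n^'n" where
  "mdiag d = (\<chi> i j. if i = j then d$i else 0)"

text \<open>Perron vector: A p = p, 1^T p = 1, p > 0.\<close>
definition perron_vector :: "real^'n^'n \<Rightarrow> real^'n \<Rightarrow> bool" where
  "perron_vector A p \<longleftrightarrow> A *v p = p \<and> sum (\<lambda>i. p$i) UNIV = 1 \<and> (\<forall>i. p$i > 0)"

definition balanced :: "real^'n^'n \<Rightarrow> real^'n \<Rightarrow> bool" where
  "balanced A p \<longleftrightarrow> mdiag p ** transpose A = A ** mdiag p"

text \<open>Action of the Kronecker product B \<otimes> I_M on a stacked vector
  W = col{w_1,...,w_N} (block k of W is W$k).\<close>
definition kron_act :: "real^'n^'n \<Rightarrow> (real^'m)^'n \<Rightarrow> (real^'m)^'n" where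
  "kron_act B W = (\<chi> l. \<Sum>k\<in>UNIV. B$l$k *\<^sub>R W$k)"

text \<open>Gradient of a differentiable function on R^M.\<close>
definition grad :: "(real^'m \<Rightarrow> real) \<Rightarrow> real^'m \<Rightarrow> real^'m" where
  "grad f w = (SOME g. (f has_derivative (\<lambda>h. g \<bullet> h)) (at w))"

definition strongly_convex :: "('a::real_normed_vector \<Rightarrow> real) \<Rightarrow> bool" where
  "strongly_convex f \<longleftrightarrow> (\<exists>\<nu>>0. \<forall>x y t. 0 \<le> t \<and> t \<le> 1 \<longrightarrow>
      f ((1 - t) *\<^sub>R x + t *\<^sub>R y) \<le> (1 - t) * f x + t * f y - \<nu> / 2 * t * (1 - t) * (norm (x - y))\<^sup>2)"

text \<open>V = U \<Sigma>^{1/2} U^T built from an eigendecomposition (P - AP)/2 = U \<Sigma> U^T,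
  U orthogonal, \<Sigma> diagonal with nonnegative entries.\<close>
definition eig_decomp :: "real^'n^'n \<Rightarrow> real^'n^'n \<Rightarrow> real^'n \<Rightarrow> bool" where
  "eig_decomp S U \<sigma> \<longleftrightarrow> orthogonal_matrix U \<and> (\<forall>i. \<sigma>$i \<ge> 0) \<and>
      S = U ** mdiag \<sigma> ** transpose U"

definition sqrt_from_decomp :: "real^'n^'n \<Rightarrow> real^'n \<Rightarrow> real^'n^'n" where
  "sqrt_from_decomp U \<sigma> = U ** mdiag (\<chi> i. sqrt (\<sigma>$i)) ** transpose U"

end

theory Submission
  imports Defs
begin

text \<open>The second equation puts every column of W into the kernel of V, which is the kernel of
  P - AP; as A is primitive with Perron vector p, that kernel is spanned by the all-ones vector,
  so W = 1 \<otimes> w. Multiplying the first equation by \<open>p\<^sup>T \<otimes> I\<close> kills the dual term, because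
  \<open>p\<^sup>T P\<^sup>-\<^sup>1 V = 1\<^sup>T V = 0\<close>, and, since (I + A)/2 fixes p, leaves
  \<open>\<Sum>\<^sub>k p\<^sub>k \<mu>\<^sub>k \<nabla>J\<^sub>k(w) = 0\<close>: w is a stationary point, hence by convexity the minimiser,
  of \<open>\<Sum>\<^sub>k q\<^sub>k J\<^sub>k\<close>. For this W the first equation prescribes VY with a right-hand side
  orthogonal to 1, which spans ker V; as V is symmetric, such a vector lies in the range of
  \<open>V\<^sup>2\<close>, and range V \<inter> ker V = 0 makes Y unique in the range of V.\<close>

text \<open>A stacked vector \<open>col{w\<^sub>1, \<dots>, w\<^sub>N}\<close> is the N \<times> M matrix with rows \<open>w\<^sub>k\<close>, and
  \<open>B \<otimes> I\<^sub>M\<close> acts on it as left multiplication by B.\<close>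
lemma kron_act_eq_matrix_mult: "kron_act = (**)"
  by (intro ext) (simp add: kron_act_def matrix_matrix_mult_def vec_eq_iff sum_component)

lemma column_matrix_mult: "column j (B ** X) = B *v column j X"
  by (simp add: column_def matrix_matrix_mult_def matrix_vector_mult_def)

lemma matrix_eq_iff_columns: "X = Y \<longleftrightarrow> (\<forall>j. column j X = column j Y)"
  by (auto simp: column_def vec_eq_iff)

lemma column_0 [simp]: "column j 0 = 0"
  by (simp add: column_def vec_eq_iff)

lemma matrix_mult_eq_0_iff_columns: "B ** X = 0 \<longleftrightarrow> (\<forall>j. B *v column j X = 0)"
  by (simp add: matrix_eq_iff_columns[of _ 0] column_matrix_mult)

lemma vector_matrix_mult_column: "(x v* Z) $ j = x \<bullet> column j Z"
  by (simp add: vector_matrix_mult_def inner_vec_def column_def mult.commute)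

lemma matrix_mult_uminus_right: "(A::'a::ring_1^'n^'m) ** (- B) = - (A ** B)"
  by (simp add: matrix_matrix_mult_def vec_eq_iff sum_negf)

lemma vector_matrix_mult_uminus_right: "(x::'a::ring_1^'m) v* (- A) = - (x v* A)"
  by (simp add: vector_matrix_mult_def vec_eq_iff sum_negf)

lemma mdiag_mult: "mdiag a ** mdiag b = mdiag (\<chi> i. a$i * b$i)"
  by (simp add: mdiag_def matrix_matrix_mult_def vec_eq_iff if_distrib[of "\<lambda>x. x * _"] cong: if_cong)

lemma mdiag_vector_mult: "mdiag a *v x = (\<chi> i. a$i * x$i)"
  by (simp add: mdiag_def matrix_vector_mult_def vec_eq_iff if_distrib[of "\<lambda>x. x * _"] cong: if_cong)

lemma ones_vector_mult_mdiag: "(\<chi> i. 1) v* mdiag a = a"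
  by (simp add: vector_matrix_mult_def mdiag_def vec_eq_iff if_distrib cong: if_cong)

lemma mdiag_one: "mdiag (\<chi> i. 1) = mat 1"
  by (simp add: mdiag_def mat_def vec_eq_iff)

lemma transpose_mdiag: "transpose (mdiag a) = mdiag a"
  by (simp add: mdiag_def transpose_def vec_eq_iff)

lemma matrix_inv_mdiag:
  assumes "\<forall>i. d$i \<noteq> 0"
  shows "matrix_inv (mdiag d) = mdiag (\<chi> i. inverse (d$i))"
proof -
  let ?D = "mdiag (\<chi> i. inverse (d$i))"
  have inv: "mdiag d ** ?D = mat 1" "?D ** mdiag d = mat 1"
    using assms by (simp_all add: mdiag_mult flip: mdiag_one)
  have "mdiag d ** matrix_inv (mdiag d) = mat 1 \<and> matrix_inv (mdiag d) ** mdiag d = mat 1"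
    unfolding matrix_inv_def by (rule someI[of _ ?D]) (use inv in blast)
  then have "matrix_inv (mdiag d) = (?D ** mdiag d) ** matrix_inv (mdiag d)"
    using inv by simp
  also have "\<dots> = ?D"
    using \<open>mdiag d ** matrix_inv (mdiag d) = mat 1 \<and> _\<close> by (simp flip: matrix_mul_assoc)
  finally show ?thesis .
qed

lemma sqrt_from_decomp_symmetric:
  "transpose (sqrt_from_decomp U \<sigma>) = sqrt_from_decomp U \<sigma>"
  by (simp add: sqrt_from_decomp_def matrix_transpose_mul transpose_mdiag matrix_mul_assoc)

lemma sqrt_from_decomp_square:
  assumes "eig_decomp S U \<sigma>"
  shows "sqrt_from_decomp U \<sigma> ** sqrt_from_decomp U \<sigma> = S"
proof -
  have U: "transpose U ** U = mat 1" and S: "S = U ** mdiag \<sigma> ** transpose U"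
    and \<sigma>: "\<forall>i. \<sigma>$i \<ge> 0"
    using assms by (auto simp: eig_decomp_def orthogonal_matrix_def)
  let ?D = "mdiag (\<chi> i. sqrt (\<sigma>$i))"
  have "sqrt_from_decomp U \<sigma> ** sqrt_from_decomp U \<sigma> = U ** ?D ** (transpose U ** U) ** ?D ** transpose U"
    by (simp add: sqrt_from_decomp_def matrix_mul_assoc)
  also have "\<dots> = U ** (?D ** ?D) ** transpose U"
    by (simp add: U matrix_mul_assoc)
  also have "?D ** ?D = mdiag \<sigma>"
    using \<sigma> by (simp add: mdiag_mult)
  finally show ?thesis
    using S by simp
qed

lemma symmetric_square_mult_eq_0_iff:
  fixes V :: "real^'n^'n"
  assumes "transpose V = V"
  shows "(V ** V) *v x = 0 \<longleftrightarrow> V *v x = 0"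
proof
  assume "(V ** V) *v x = 0"
  moreover have "(V *v x) \<bullet> (V *v x) = x \<bullet> ((V ** V) *v x)"
    by (metis assms dot_lmul_matrix matrix_vector_mul_assoc transpose_matrix_vector)
  ultimately show "V *v x = 0"
    by simp
qed (simp flip: matrix_vector_mul_assoc)

text \<open>The component of \<open>z\<close> orthogonal to the range of \<open>S\<close> lies in the kernel of
  \<open>S = S\<^sup>T\<close>, hence is orthogonal to \<open>z\<close>, hence vanishes.\<close>
lemma symmetric_matrix_range:
  fixes S :: "real^'n^'n"
  assumes sym: "transpose S = S" and z: "\<And>x. S *v x = 0 \<Longrightarrow> z \<bullet> x = 0"
  shows "\<exists>t. S *v t = z"
proof -
  have range_subspace: "subspace (range ((*v) S))"
    by (simp add: linear_subspace_image matrix_vector_mul_linear)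
  obtain y r where y: "y \<in> range ((*v) S)" and r: "\<And>w. w \<in> range ((*v) S) \<Longrightarrow> orthogonal r w"
    and zyr: "z = y + r"
    using orthogonal_subspace_decomp_exists[of "range ((*v) S)" z]
    unfolding span_eq_iff[THEN iffD2, OF range_subspace] by blast
  have "(S *v r) \<bullet> t = 0" for t
    using r[of "S *v t"] sym by (metis dot_lmul_matrix orthogonal_def rangeI transpose_matrix_vector)
  then have "S *v r = 0"
    by (metis inner_eq_zero_iff)
  then have "z \<bullet> r = 0"
    by (rule z)
  moreover have "y \<bullet> r = 0"
    using r[OF y] by (simp add: orthogonal_def inner_commute)
  ultimately have "r = 0"
    using zyr by (simp add: inner_add_left)
  then show ?thesis
    using y zyr by auto
qed

lemma symmetric_matrix_mult_solvable:
  fixes S :: "real^'n^'n" and Z :: "real^'m^'n"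
  assumes sym: "transpose S = S" and Z: "\<And>x. S *v x = 0 \<Longrightarrow> x v* Z = 0"
  shows "\<exists>T. S ** T = Z"
proof -
  have "\<forall>j. \<exists>t. S *v t = column j Z"
  proof
    fix j
    have "column j Z \<bullet> x = 0" if "S *v x = 0" for x
      using Z[OF that] by (simp add: inner_commute vec_eq_iff vector_matrix_mult_column)
    then show "\<exists>t. S *v t = column j Z"
      by (rule symmetric_matrix_range[OF sym])
  qed
  then obtain t where t: "\<And>j. S *v t j = column j Z"
    by (metis choice)
  have "column j (\<chi> i j. t j $ i) = t j" for j
    by (simp add: column_def)
  then have "S ** (\<chi> i j. t j $ i) = Z"
    using t by (simp add: matrix_eq_iff_columns column_matrix_mult)
  then show ?thesis ..
qed

lemma symmetric_matrix_mult_inj_on_range: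
  fixes V :: "real^'n^'n" and Y Y' :: "real^'m^'n"
  assumes sym: "transpose V = V"
    and range: "Y \<in> range ((**) V)" "Y' \<in> range ((**) V)" and eq: "V ** Y = V ** Y'"
  shows "Y = Y'"
proof -
  obtain T1 T2 where Y: "Y = V ** T1" "Y' = V ** T2"
    using range by blast
  have "(V ** V) *v (column j T1 - column j T2) = 0" for j
  proof -
    have "column j (V ** Y) = column j (V ** Y')"
      using eq by simp
    then show ?thesis
      by (simp add: Y column_matrix_mult matrix_vector_mult_diff_distrib matrix_vector_mul_assoc)
  qed
  then have "V *v (column j T1 - column j T2) = 0" for j
    using symmetric_square_mult_eq_0_iff[OF sym] by blast
  then have "column j Y = column j Y'" for j
    by (simp add: Y column_matrix_mult matrix_vector_mult_diff_distrib)
  then show ?thesis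
    using matrix_eq_iff_columns by blast
qed

lemma ex1_symmetric_range_solution:
  fixes V :: "real^'n^'n" and Z :: "real^'m^'n"
  assumes sym: "transpose V = V" and Z: "\<And>x. V *v x = 0 \<Longrightarrow> x v* Z = 0"
  shows "\<exists>!Y. Y \<in> range ((**) V) \<and> V ** Y = Z"
proof -
  have "transpose (V ** V) = V ** V"
    by (simp add: matrix_transpose_mul sym)
  then obtain T where "(V ** V) ** T = Z"
    using symmetric_matrix_mult_solvable Z symmetric_square_mult_eq_0_iff[OF sym] by blast
  then have "V ** (V ** T) = Z"
    by (simp add: matrix_mul_assoc)
  then show ?thesis
    using symmetric_matrix_mult_inj_on_range[OF sym] by (intro ex1I[of _ "V ** T"]) auto
qed

lemma mpow_fixed_point: "A *v y = y \<Longrightarrow> mpow A k *v y = y"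
  by (induction k) (auto simp flip: matrix_vector_mul_assoc)

text \<open>Subtracting from \<open>y\<close> the largest multiple of \<open>p\<close> below it leaves a nonnegative fixed
  point of \<open>A\<close> with a zero entry; a positive power of \<open>A\<close> forces it to vanish.\<close>
lemma primitive_fixed_point_unique:
  fixes A :: "real^'n^'n"
  assumes prim: "primitive_matrix A" and Ap: "A *v p = p" and p_pos: "\<forall>i. p$i > 0"
    and Ay: "A *v y = y"
  shows "\<exists>c. y = c *\<^sub>R p"
proof -
  obtain k where B_pos: "\<forall>i j. mpow A k $i$j > 0"
    using prim by (auto simp: primitive_matrix_def)
  define c where "c = Min (range (\<lambda>i. y$i / p$i))"
  have "c \<in> range (\<lambda>i. y$i / p$i)"
    unfolding c_def by (rule Min_in) auto
  then obtain i0 where i0: "c = y$i0 / p$i0"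
    by blast
  define z where "z = y - c *\<^sub>R p"
  have z_nonneg: "z$i \<ge> 0" for i
  proof -
    have "c \<le> y$i / p$i"
      unfolding c_def by (rule Min_le) auto
    then show ?thesis
      using p_pos by (simp add: z_def pos_le_divide_eq)
  qed
  have "z$i0 = 0"
    using i0 p_pos[rule_format, of i0] by (simp add: z_def)
  moreover have "mpow A k *v z = z"
    using mpow_fixed_point[OF Ay, of k] mpow_fixed_point[OF Ap, of k]
    by (simp add: z_def matrix_vector_mult_diff_distrib matrix_vector_mult_scaleR)
  ultimately have "(mpow A k *v z)$i0 = 0"
    by simp
  then have "(\<Sum>j\<in>UNIV. mpow A k $i0$j * z$j) = 0"
    by (simp add: matrix_vector_mult_def)
  then have "mpow A k $i0$j * z$j = 0" for j
    using z_nonneg B_pos by (simp add: sum_nonneg_eq_0_iff less_imp_le)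
  then have "z$j = 0" for j
    using B_pos by (metis less_irrefl mult_eq_0_iff)
  then show ?thesis
    by (auto simp: z_def vec_eq_iff intro: exI[of _ c])
qed

lemma perron_laplacian_kernel:
  fixes A :: "real^'n^'n"
  assumes prim: "primitive_matrix A" and perron: "perron_vector A p"
  shows "(mdiag p - A ** mdiag p) *v x = 0 \<longleftrightarrow> (\<exists>c. x = c *\<^sub>R (\<chi> i. 1))"
proof -
  have Ap: "A *v p = p" and p_pos: "\<forall>i. p$i > 0"
    using perron by (auto simp: perron_vector_def)
  have "(mdiag p - A ** mdiag p) *v x = 0 \<longleftrightarrow> A *v (mdiag p *v x) = mdiag p *v x"
    by (auto simp: matrix_vector_mult_diff_rdistrib simp flip: matrix_vector_mul_assoc)
  also have "\<dots> \<longleftrightarrow> (\<exists>c. mdiag p *v x = c *\<^sub>R p)"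
    using primitive_fixed_point_unique[OF prim Ap p_pos] Ap
    by (auto simp: matrix_vector_mult_scaleR)
  also have "\<dots> \<longleftrightarrow> (\<exists>c. x = c *\<^sub>R (\<chi> i. 1))"
  proof -
    have "p$i * x$i = c * p$i \<longleftrightarrow> x$i = c" for i c
      using p_pos[rule_format, of i] by (auto simp: mult.commute)
    then show ?thesis
      by (simp add: mdiag_vector_mult vec_eq_iff)
  qed
  finally show ?thesis .
qed

lemma sqrt_laplacian_kernel:
  fixes A :: "real^'n^'n"
  assumes prim: "primitive_matrix A" and perron: "perron_vector A p"
    and decomp: "eig_decomp ((1/2) *\<^sub>R (mdiag p - A ** mdiag p)) U \<sigma>"
  shows "sqrt_from_decomp U \<sigma> *v x = 0 \<longleftrightarrow> (\<exists>c. x = c *\<^sub>R (\<chi> i. 1))"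
proof -
  have "sqrt_from_decomp U \<sigma> *v x = 0 \<longleftrightarrow> (1/2) *\<^sub>R ((mdiag p - A ** mdiag p) *v x) = 0"
    using symmetric_square_mult_eq_0_iff[OF sqrt_from_decomp_symmetric, of U \<sigma> x]
    by (simp add: sqrt_from_decomp_square[OF decomp] scaleR_matrix_vector_assoc)
  then show ?thesis
    using perron_laplacian_kernel[OF prim perron] by simp
qed

lemma matrix_mult_eq_0_iff_consensus:
  fixes V :: "real^'n^'n" and W :: "real^'m^'n"
  assumes ker: "\<And>x. V *v x = 0 \<longleftrightarrow> (\<exists>c. x = c *\<^sub>R (\<chi> i. 1))"
  shows "V ** W = 0 \<longleftrightarrow> (\<exists>w. W = (\<chi> k. w))"
proof
  assume "V ** W = 0"
  then have col: "\<exists>c. column j W = c *\<^sub>R (\<chi> i. 1)" for j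
    using ker by (simp add: matrix_mult_eq_0_iff_columns)
  have "W$k$j = W$l$j" for k l j
  proof -
    obtain c where "column j W = c *\<^sub>R (\<chi> i. 1)"
      using col by blast
    then have "\<forall>i. W$i$j = c"
      by (simp add: column_def vec_eq_iff)
    then show ?thesis
      by simp
  qed
  then show "\<exists>w. W = (\<chi> k. w)"
    by (intro exI[of _ "W$undefined"]) (simp add: vec_eq_iff)
next
  assume "\<exists>w. W = (\<chi> k. w)"
  then have "column j W = W$undefined$j *\<^sub>R (\<chi> i. 1)" for j
    by (auto simp: column_def vec_eq_iff)
  then show "V ** W = 0"
    using ker by (simp add: matrix_mult_eq_0_iff_columns)
qed

lemma add_inverse_mult_eq_0_iff:
  fixes D D' :: "'a::comm_ring_1^'n^'n" and X Y :: "'a^'m^'n"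
  assumes "D' ** D = mat 1" "D ** D' = mat 1"
  shows "X + D' ** Y = 0 \<longleftrightarrow> Y = - (D ** X)"
proof -
  have "X + D' ** Y = 0 \<longleftrightarrow> D' ** Y = - X"
    by (simp add: eq_neg_iff_add_eq_0 add.commute)
  also have "\<dots> \<longleftrightarrow> Y = - (D ** X)"
  proof
    assume "D' ** Y = - X"
    then have "D ** (D' ** Y) = - (D ** X)"
      by (simp add: matrix_mult_uminus_right)
    then show "Y = - (D ** X)"
      using assms(2) by (simp add: matrix_mul_assoc)
  next
    assume "Y = - (D ** X)"
    then show "D' ** Y = - X"
      using assms(1) by (simp add: matrix_mult_uminus_right matrix_mul_assoc)
  qed
  finally show ?thesis .
qed

lemma ones_vector_mult_mdiag_transpose:
  assumes "B *v p = p"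
  shows "(\<chi> i. 1) v* (mdiag p ** (transpose B ** X)) = p v* X"
  using assms by (simp add: ones_vector_mult_mdiag flip: vector_matrix_mul_assoc)

lemma saddle_point_ex1:
  fixes V B P' :: "real^'n^'n" and p :: "real^'n" and G :: "real^'m^'n \<Rightarrow> real^'m^'n"
  assumes sym: "transpose V = V"
    and kerV: "\<And>x. V *v x = 0 \<longleftrightarrow> (\<exists>c. x = c *\<^sub>R (\<chi> i. 1))"
    and Bp: "B *v p = p"
    and P': "P' ** mdiag p = mat 1" "mdiag p ** P' = mat 1"
    and stationary: "\<And>w. p v* G (\<chi> k. w) = 0 \<longleftrightarrow> w = wstar"
  shows "\<exists>!(W, Y). Y \<in> range ((**) V) \<and> transpose B ** G W + P' ** (V ** Y) = 0 \<and> V ** W = 0"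
proof -
  define Z where "Z W = - (mdiag p ** (transpose B ** G W))" for W
  have eq_iff: "transpose B ** G W + P' ** (V ** Y) = 0 \<longleftrightarrow> V ** Y = Z W" for W Y
    unfolding Z_def by (rule add_inverse_mult_eq_0_iff[OF P'])
  have one_Z: "(\<chi> i. 1) v* Z W = - (p v* G W)" for W
    by (simp add: Z_def vector_matrix_mult_uminus_right ones_vector_mult_mdiag_transpose[OF Bp])
  have "V *v (\<chi> i. 1) = 0"
    using kerV[of "\<chi> i. 1"] by (auto intro: exI[of _ 1])
  then have one_V: "(\<chi> i. 1) v* V = 0"
    using transpose_matrix_vector[of V "\<chi> i. 1"] sym by simp
  define W0 :: "real^'m^'n" where "W0 = (\<chi> k. wstar)"
  have W0: "W = W0" if "V ** Y = Z W" "V ** W = 0" for W Y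
  proof -
    obtain w where w: "W = (\<chi> k. w)"
      using \<open>V ** W = 0\<close> matrix_mult_eq_0_iff_consensus[OF kerV] by blast
    have "p v* G W = - ((\<chi> i. 1) v* (V ** Y))"
      using one_Z that(1) by simp
    also have "\<dots> = 0"
      using one_V by (simp flip: vector_matrix_mul_assoc)
    finally show ?thesis
      using stationary w W0_def by simp
  qed
  have "\<exists>!Y. Y \<in> range ((**) V) \<and> V ** Y = Z W0"
  proof (rule ex1_symmetric_range_solution[OF sym])
    fix x assume "V *v x = 0"
    then obtain c where "x = c *\<^sub>R (\<chi> i. 1)"
      using kerV by blast
    then show "x v* Z W0 = 0"
      using one_Z stationary W0_def by (simp add: scaleR_vector_matrix_assoc)
  qed
  then obtain Y0 where Y0: "Y0 \<in> range ((**) V)" "V ** Y0 = Z W0"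
    and Y0_unique: "\<And>Y. Y \<in> range ((**) V) \<Longrightarrow> V ** Y = Z W0 \<Longrightarrow> Y = Y0"
    by blast
  have "V ** W0 = 0"
    using matrix_mult_eq_0_iff_consensus[OF kerV] W0_def by blast
  show ?thesis
  proof (rule ex1I[of _ "(W0, Y0)"])
    fix WY :: "(real^'m^'n) \<times> (real^'m^'n)"
    assume "case WY of (W, Y) \<Rightarrow> Y \<in> range ((**) V) \<and> transpose B ** G W + P' ** (V ** Y) = 0 \<and> V ** W = 0"
    then show "WY = (W0, Y0)"
      using W0 Y0_unique eq_iff by (auto split: prod.splits)
  qed (use Y0 \<open>V ** W0 = 0\<close> eq_iff in auto)
qed

lemma grad_has_derivative:
  fixes f :: "real^'m \<Rightarrow> real"
  assumes "f differentiable (at w)"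
  shows "(f has_derivative (\<lambda>h. grad f w \<bullet> h)) (at w)"
proof -
  obtain D where D: "(f has_derivative D) (at w)"
    using assms by (auto simp: differentiable_def)
  have "D h = adjoint D 1 \<bullet> h" for h
    using adjoint_works[OF has_derivative_linear[OF D], of h 1] by (simp add: inner_commute)
  then have "D = (\<lambda>h. adjoint D 1 \<bullet> h)"
    by (simp add: fun_eq_iff)
  with D have "(f has_derivative (\<lambda>h. adjoint D 1 \<bullet> h)) (at w)"
    by simp
  then show ?thesis
    unfolding grad_def by (rule someI)
qed

lemma convex_stationary_point_is_minimum:
  fixes F :: "'a::real_normed_vector \<Rightarrow> real"
  assumes convex: "convex_on UNIV F" and der: "(F has_derivative (\<lambda>h. 0)) (at w)"
  shows "F w \<le> F x"
proof -
  define \<phi> where "\<phi> = (\<lambda>t::real. F (w + t *\<^sub>R (x - w)))"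
  have "convex_on UNIV \<phi>"
  proof (rule convex_onI)
    fix t a b :: real
    assume "0 < t" "t < 1"
    have "(1 - t) *\<^sub>R (w + a *\<^sub>R (x - w)) + t *\<^sub>R (w + b *\<^sub>R (x - w)) = w + ((1 - t) * a + t * b) *\<^sub>R (x - w)"
      by (simp add: algebra_simps)
    then show "\<phi> ((1 - t) *\<^sub>R a + t *\<^sub>R b) \<le> (1 - t) * \<phi> a + t * \<phi> b"
      unfolding \<phi>_def
      using \<open>0 < t\<close> \<open>t < 1\<close> convex_onD[OF convex, of t "w + a *\<^sub>R (x - w)" "w + b *\<^sub>R (x - w)"]
      by simp
  qed auto
  moreover have "((\<lambda>t::real. w + t *\<^sub>R (x - w)) has_derivative (\<lambda>t. t *\<^sub>R (x - w))) (at 0)"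
    by (auto intro!: derivative_eq_intros)
  from has_derivative_compose[OF this] der have "(\<phi> has_derivative (\<lambda>t. 0)) (at 0)"
    by (simp add: \<phi>_def comp_def)
  then have "(\<phi> has_field_derivative 0) (at 0)"
    by (simp add: has_field_derivative_def lambda_zero)
  ultimately have "\<phi> 1 - \<phi> 0 \<ge> 0 * (1 - 0)"
    by (intro convex_on_imp_above_tangent) auto
  then show ?thesis
    unfolding \<phi>_def by simp
qed

lemma convex_minimum_iff_gradient_zero:
  fixes F :: "real^'m \<Rightarrow> real"
  assumes convex: "convex_on UNIV F" and der: "(F has_derivative (\<lambda>h. g \<bullet> h)) (at w)"
  shows "(\<forall>x. F w \<le> F x) \<longleftrightarrow> g = 0"
proof
  assume "\<forall>x. F w \<le> F x"
  then have "(\<lambda>h. g \<bullet> h) = (\<lambda>h. 0)"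
    by (intro differential_zero_maxmin[OF _ _ der, of UNIV]) auto
  then have "g \<bullet> g = 0"
    by (rule fun_cong)
  then show "g = 0"
    by simp
qed (use convex_stationary_point_is_minimum[OF convex] der in auto)

lemma convex_on_sum_fun:
  assumes "finite I" "\<And>i. i \<in> I \<Longrightarrow> convex_on UNIV (f i)"
  shows "convex_on UNIV (\<lambda>x. \<Sum>i\<in>I. f i x)"
  using assms by (induction I rule: finite_induct) (auto simp: convex_on_const)

lemma sum_gradient_eq_0_iff_minimum:
  fixes J :: "'i \<Rightarrow> real^'m \<Rightarrow> real"
  assumes "finite I" and convex: "\<forall>k\<in>I. convex_on UNIV (J k)"
    and diff: "\<forall>k w. J k differentiable (at w)" and q: "\<forall>k\<in>I. q k \<ge> 0"
  shows "(\<Sum>k\<in>I. q k *\<^sub>R grad (J k) w) = 0 \<longleftrightarrow> (\<forall>x. (\<Sum>k\<in>I. q k * J k w) \<le> (\<Sum>k\<in>I. q k * J k x))"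
proof (rule convex_minimum_iff_gradient_zero[symmetric])
  show "convex_on UNIV (\<lambda>x. \<Sum>k\<in>I. q k * J k x)"
    using assms by (intro convex_on_sum_fun convex_on_cmul) auto
  have "((\<lambda>x. \<Sum>k\<in>I. q k * J k x) has_derivative (\<lambda>h. \<Sum>k\<in>I. q k * (grad (J k) w \<bullet> h))) (at w)"
    using diff by (intro has_derivative_sum has_derivative_mult_right grad_has_derivative) auto
  then show "((\<lambda>x. \<Sum>k\<in>I. q k * J k x) has_derivative (\<lambda>h. (\<Sum>k\<in>I. q k *\<^sub>R grad (J k) w) \<bullet> h)) (at w)"
    by (simp add: inner_sum_left)
qed

lemma weighted_gradient_eq_0_iff_minimum:
  fixes p q \<mu> :: "real^'n" and J :: "'n \<Rightarrow> real^'m \<Rightarrow> real"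
  assumes q_def: "q = \<beta> *\<^sub>R (mdiag \<mu> *v p)" and beta_pos: "\<beta> > 0" and q_pos: "\<forall>k. q$k > 0"
    and J_convex: "\<forall>k. convex_on UNIV (J k)" and J_diff: "\<forall>k w. J k differentiable (at w)"
  shows "p v* (\<chi> k. \<mu>$k *\<^sub>R grad (J k) w) = 0 \<longleftrightarrow>
    (\<forall>x. (\<Sum>k\<in>UNIV. q$k * J k w) \<le> (\<Sum>k\<in>UNIV. q$k * J k x))"
proof -
  have "\<beta> *\<^sub>R (p v* (\<chi> k. \<mu>$k *\<^sub>R grad (J k) w)) = (\<Sum>k\<in>UNIV. q$k *\<^sub>R grad (J k) w)"
    by (simp add: q_def mdiag_vector_mult vector_matrix_mult_def vec_eq_iff sum_component
        sum_distrib_left algebra_simps)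
  moreover have "(\<Sum>k\<in>UNIV. q$k *\<^sub>R grad (J k) w) = 0 \<longleftrightarrow>
      (\<forall>x. (\<Sum>k\<in>UNIV. q$k * J k w) \<le> (\<Sum>k\<in>UNIV. q$k * J k x))"
    using sum_gradient_eq_0_iff_minimum[of UNIV J "\<lambda>k. q$k" w] J_convex J_diff q_pos
    by (simp add: less_imp_le)
  ultimately show ?thesis
    using beta_pos by force
qed

theorem lemma3:
  fixes A :: "real^'n^'n" and p :: "real^'n"
    and J :: "'n \<Rightarrow> real^'m \<Rightarrow> real"
    and q \<mu> :: "real^'n" and \<beta> :: real
    and U :: "real^'n^'n" and \<sigma> :: "real^'n"
  assumes N2: "CARD('n) \<ge> 2"
    and q_pos: "\<forall>k. q$k > 0"
    and J_convex: "\<forall>k. convex_on UNIV (J k)"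
    and J_diff: "\<forall>k w. J k differentiable (at w)"
    and qJ_sc: "strongly_convex (\<lambda>w. \<Sum>k\<in>UNIV. q$k * J k w)"
    and qJ_min: "\<exists>!wstar. \<forall>w. (\<Sum>k\<in>UNIV. q$k * J k wstar) \<le> (\<Sum>k\<in>UNIV. q$k * J k w)"
    and J_sc: "strongly_convex (\<lambda>w. \<Sum>k\<in>UNIV. J k w)"
    and A_prim: "primitive_matrix A"
    and A_ls: "left_stochastic A"
    and p_perron: "perron_vector A p"
    and A_bal: "balanced A p"
    and mu_pos: "\<forall>k. \<mu>$k > 0"
    and beta_pos: "\<beta> > 0"
    and q_def: "q = \<beta> *\<^sub>R (mdiag \<mu> *v p)"
    and decomp: "eig_decomp ((1/2) *\<^sub>R (mdiag p - A ** mdiag p)) U \<sigma>"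
  shows "\<exists>!(W, Y). Y \<in> range (kron_act (sqrt_from_decomp U \<sigma>)) \<and>
     kron_act (transpose ((1/2) *\<^sub>R (mat 1 + A)))
        (\<chi> k. \<mu>$k *\<^sub>R grad (J k) (W$k))
     + kron_act (matrix_inv (mdiag p)) (kron_act (sqrt_from_decomp U \<sigma>) Y) = 0 \<and>
     kron_act (sqrt_from_decomp U \<sigma>) W = (0 :: (real^'m)^'n)"
proof -
  have Ap: "A *v p = p" and p_pos: "\<forall>i. p$i > 0"
    using p_perron by (auto simp: perron_vector_def)
  obtain wstar where wstar: "\<And>w. (\<forall>x. (\<Sum>k\<in>UNIV. q$k * J k w) \<le> (\<Sum>k\<in>UNIV. q$k * J k x)) \<longleftrightarrow> w = wstar"
    using qJ_min by metis
  define G where "G W = (\<chi> k. \<mu>$k *\<^sub>R grad (J k) (W$k))" for W :: "real^'m^'n"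
  have stationary: "p v* G (\<chi> k. w) = 0 \<longleftrightarrow> w = wstar" for w
    using weighted_gradient_eq_0_iff_minimum[OF q_def beta_pos q_pos J_convex J_diff] wstar
    by (simp add: G_def)
  have "((1/2) *\<^sub>R (mat 1 + A)) *v p = p"
    using Ap by (simp add: matrix_vector_mult_add_rdistrib flip: scaleR_matrix_vector_assoc scaleR_2)
  moreover have "matrix_inv (mdiag p) ** mdiag p = mat 1" "mdiag p ** matrix_inv (mdiag p) = mat 1"
    using p_pos by (simp_all add: matrix_inv_mdiag less_imp_neq[symmetric] mdiag_mult flip: mdiag_one)
  ultimately have "\<exists>!(W, Y). Y \<in> range ((**) (sqrt_from_decomp U \<sigma>)) \<and>
      transpose ((1/2) *\<^sub>R (mat 1 + A)) ** G W + matrix_inv (mdiag p) ** (sqrt_from_decomp U \<sigma> ** Y) = 0 \<and>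
      sqrt_from_decomp U \<sigma> ** W = 0"
    by (rule saddle_point_ex1[OF sqrt_from_decomp_symmetric sqrt_laplacian_kernel[OF A_prim p_perron decomp]
          _ _ _ stationary])
  then show ?thesis
    unfolding kron_act_eq_matrix_mult G_def .
qed

end
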